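(* Let $R$ be a hemiring with identity. The following statements are equivalent: (1) Each $h$-ideal $A$ of $R$ is $h$-idempotent, i.e. $\overline{AA}=A$. (2) $A\cap B=\overline{AB}$ for each pair $A,B$ of $h$-ideals of $R$. (3) Each fuzzy $h$-ideal $\lambda$ of $R$ is idempotent, i.e. $\lambda\odot_h\lambda=\lambda$. (4) $\lambda\odot_h\mu=\lambda\wedge\mu$ for all fuzzy $h$-ideals $\lambda,\mu$ of $R$.
   Context: A hemiring is a set $R$ with operations $+$ and $\cdot$ such that $(R,+)$ is a commutative semigroup, $(R,\cdot)$ is a semigroup, multiplication distributes over addition on both sides, and there is $0\in R$ with $a+0=0+a=a$ and $a0=0a=0$ for all $a\in R$. An identity is an element $1\in R$ with $1a=a1=a$ for all $a$. An $h$-ideal of $R$ is a non-empty subset $I$ closed under addition, with $ra,ar\in I$ for all $a\in I$, $r\in R$, and such that $x+a+y=b+y$ with $a,b\in I$, $x,y\in R$ implies $x\in I$. For subsets $A,B$, $AB$ is the set of finite sums of products $ab$ with $a\in A$, $b\in B$. The $h$-closure of a non-empty $A\subseteq R$ is $\overline{A}=\{x\in R\mid x+a+y=b+y\text{ for some }a,b\in A,\ y\in R\}$. A fuzzy subset of $R$ is a map $\lambda:R\to[0,1]$; $\wedge$ denotes (pointwise) minimum. A fuzzy $h$-ideal of $R$ is a fuzzy subset $\lambda$ such that for all $a,b,x,y\in R$: $\lambda(a+b)\geq\lambda(a)\wedge\lambda(b)$; $\lambda(ab)\geq\lambda(a)$ and $\lambda(ab)\geq\lambda(b)$; and $x+a+y=b+y$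 implies $\lambda(x)\geq\lambda(a)\wedge\lambda(b)$. The $h$-intrinsic product of fuzzy subsets $\mu,\nu$ is $(\mu\odot_h\nu)(x)=\sup\big(\bigwedge_{i=1}^m(\mu(a_i)\wedge\nu(b_i))\wedge\bigwedge_{j=1}^n(\mu(a_j')\wedge\nu(b_j'))\big)$, the supremum being over all expressions $x+\sum_{i=1}^m a_ib_i+z=\sum_{j=1}^n a_j'b_j'+z$ with $m,n\geq1$ and $a_i,b_i,a_j',b_j',z\in R$, and $(\mu\odot_h\nu)(x)=0$ if no such expression exists. *)

theory Defs
  imports Complex_Main
begin

text \<open>
  A hemiring is a type of class \<open>semiring_0\<close>, and a hemiring with identity is a type of
  sort \<open>{semiring_0, monoid_mult}\<close>. The class \<open>semiring_1\<close> is not used because it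
  additionally demands \<open>0 \<noteq> 1\<close>.
\<close>

definition h_ideal :: "'a::semiring_0 set \<Rightarrow> bool" where
  "h_ideal I \<longleftrightarrow>
     I \<noteq> {} \<and>
     (\<forall>a\<in>I. \<forall>b\<in>I. a + b \<in> I) \<and>
     (\<forall>a\<in>I. \<forall>r. r * a \<in> I \<and> a * r \<in> I) \<and>
     (\<forall>x y. \<forall>a\<in>I. \<forall>b\<in>I. x + a + y = b + y \<longrightarrow> x \<in> I)"

definition set_product :: "'a::semiring_0 set \<Rightarrow> 'a set \<Rightarrow> 'a set" where
  "set_product A B =
     {\<Sum>i=1..m. a i * b i | (m::nat) a b. 1 \<le> m \<and> (\<forall>i\<in>{1..m}. a i \<in> A \<and> b i \<in> B)}"

definition h_closure :: "'a::semiring_0 set \<Rightarrow> 'a set" where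
  "h_closure A = {x. \<exists>a\<in>A. \<exists>b\<in>A. \<exists>y. x + a + y = b + y}"

definition h_idempotent :: "'a::semiring_0 set \<Rightarrow> bool" where
  "h_idempotent A \<longleftrightarrow> h_closure (set_product A A) = A"

definition fuzzy_subset :: "('a \<Rightarrow> real) \<Rightarrow> bool" where
  "fuzzy_subset \<mu> \<longleftrightarrow> (\<forall>x. 0 \<le> \<mu> x \<and> \<mu> x \<le> 1)"

definition fuzzy_min :: "('a \<Rightarrow> real) \<Rightarrow> ('a \<Rightarrow> real) \<Rightarrow> 'a \<Rightarrow> real" where
  "fuzzy_min \<mu> \<nu> = (\<lambda>x. min (\<mu> x) (\<nu> x))"

definition fuzzy_h_ideal :: "('a::semiring_0 \<Rightarrow> real) \<Rightarrow> bool" where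
  "fuzzy_h_ideal \<mu> \<longleftrightarrow>
     fuzzy_subset \<mu> \<and>
     (\<forall>a b. \<mu> (a + b) \<ge> min (\<mu> a) (\<mu> b)) \<and>
     (\<forall>a b. \<mu> (a * b) \<ge> \<mu> a \<and> \<mu> (a * b) \<ge> \<mu> b) \<and>
     (\<forall>a b x y. x + a + y = b + y \<longrightarrow> \<mu> x \<ge> min (\<mu> a) (\<mu> b))"

text \<open>
  The values over which the supremum in the \<open>h\<close>-intrinsic product at \<open>x\<close> is taken, one for
  each expression \<open>x + a\<^sub>1 b\<^sub>1 + \<dots> + a\<^sub>m b\<^sub>m + z = a'\<^sub>1 b'\<^sub>1 + \<dots> + a'\<^sub>n b'\<^sub>n + z\<close>.
\<close>

definition h_product_values ::
  "('a::semiring_0 \<Rightarrow> real) \<Rightarrow> ('a \<Rightarrow> real) \<Rightarrow> 'a \<Rightarrow> real set" where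
  "h_product_values \<mu> \<nu> x =
     {min (Min ((\<lambda>i. min (\<mu> (a i)) (\<nu> (b i))) ` {1..m}))
          (Min ((\<lambda>j. min (\<mu> (a' j)) (\<nu> (b' j))) ` {1..n}))
      | (m::nat) (n::nat) a b a' b' z.
        1 \<le> m \<and> 1 \<le> n \<and>
        x + (\<Sum>i=1..m. a i * b i) + z = (\<Sum>j=1..n. a' j * b' j) + z}"

text \<open>
  For fuzzy subsets the value set is bounded above by 1, so \<open>Sup\<close> on the reals is the
  supremum as soon as the set is non-empty.
\<close>

definition h_intrinsic_product ::
  "('a::semiring_0 \<Rightarrow> real) \<Rightarrow> ('a \<Rightarrow> real) \<Rightarrow> 'a \<Rightarrow> real"  (infixl "\<odot>\<^sub>h" 70) where
  "\<mu> \<odot>\<^sub>h \<nu> = (\<lambda>x. if h_product_values \<mu> \<nu> x = {} then 0 else Sup (h_product_values \<mu> \<nu> x))"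

end

theory Submission
  imports Defs
begin

text \<open>
  A real \<open>t\<close> is dominated by some value of an expression for \<open>x\<close> in the product of \<open>\<mu>\<close> and
  \<open>\<nu>\<close> iff \<open>x\<close> lies in the \<open>h\<close>-closure of the product of the level sets of \<open>\<mu>\<close> and \<open>\<nu>\<close>
  at height \<open>t\<close>. Level sets of fuzzy \<open>h\<close>-ideals are \<open>h\<close>-ideals, so the fuzzy statements are
  the crisp ones read level by level; conversely, the crisp statement for \<open>A\<close> is recovered from the
  characteristic function of \<open>A\<close> at height \<open>1/2\<close>. The crisp statements are related by applying
  idempotence to \<open>A \<inter> B\<close>.
\<close>

definition level_set :: "('a \<Rightarrow> real) \<Rightarrow> real \<Rightarrow> 'a set" where
  "level_set \<mu> t = {x. t \<le> \<mu> x}"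

text \<open>A point common to all \<open>h\<close>-ideals: it makes their intersections non-empty,
  and it is the value of a sum over an empty or infinite index set.\<close>

lemma h_ideal_zero:
  assumes "h_ideal A"
  shows "0 \<in> A"
proof -
  obtain a where "a \<in> A" using assms by (auto simp: h_ideal_def)
  then have "0 * a \<in> A" using assms unfolding h_ideal_def by blast
  then show ?thesis by simp
qed

lemma h_ideal_sum:
  assumes "h_ideal A" and "\<And>i. i \<in> S \<Longrightarrow> f i \<in> A"
  shows "sum f S \<in> A"
  using assms(2)
proof (induction S rule: infinite_finite_induct)
  case (insert i S)
  then have "f i \<in> A" "sum f S \<in> A" by auto
  then have "f i + sum f S \<in> A" using assms(1) unfolding h_ideal_def by blast
  then show ?case using insert by simp
qed (use h_ideal_zero[OF assms(1)] in auto)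

lemma h_ideal_Int:
  assumes "h_ideal A" and "h_ideal B"
  shows "h_ideal (A \<inter> B)"
proof -
  have "0 \<in> A \<inter> B" using assms by (simp add: h_ideal_zero)
  then show ?thesis using assms unfolding h_ideal_def by blast
qed

lemma set_product_mono: "A \<subseteq> C \<Longrightarrow> B \<subseteq> D \<Longrightarrow> set_product A B \<subseteq> set_product C D"
  unfolding set_product_def by blast

lemma h_closure_mono: "A \<subseteq> B \<Longrightarrow> h_closure A \<subseteq> h_closure B"
  unfolding h_closure_def by blast

lemma h_closure_subset: "h_ideal A \<Longrightarrow> B \<subseteq> A \<Longrightarrow> h_closure B \<subseteq> A"
  unfolding h_closure_def h_ideal_def by blast

text \<open>Since the ideals are two-sided, each product \<open>a i * b i\<close> lies in both
  \<open>A\<close> and \<open>B\<close>.\<close>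

lemma set_product_subset_Int:
  assumes "h_ideal A" and "h_ideal B"
  shows "set_product A B \<subseteq> A \<inter> B"
proof
  fix x assume "x \<in> set_product A B"
  then obtain m :: nat and a b
    where x: "x = (\<Sum>i=1..m. a i * b i)" and ab: "\<forall>i\<in>{1..m}. a i \<in> A \<and> b i \<in> B"
    unfolding set_product_def by blast
  have "h_ideal (A \<inter> B)" using assms by (rule h_ideal_Int)
  moreover have "a i * b i \<in> A \<inter> B" if "i \<in> {1..m}" for i
    using that ab assms unfolding h_ideal_def by blast
  ultimately show "x \<in> A \<inter> B" unfolding x by (rule h_ideal_sum)
qed

text \<open>This half of the crisp equalities holds in every hemiring; only the converse inclusion
  is a condition on it.\<close>

lemma h_closure_set_product_subset_Int:
  assumes "h_ideal A" and "h_ideal B"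
  shows "h_closure (set_product A B) \<subseteq> A \<inter> B"
  by (rule h_closure_subset[OF h_ideal_Int[OF assms] set_product_subset_Int[OF assms]])

text \<open>The point \<open>x\<close> guarantees non-emptiness, which fails once \<open>t\<close>
  exceeds every value of \<open>\<mu>\<close>.\<close>

lemma h_ideal_level_set:
  assumes "fuzzy_h_ideal \<mu>" and "x \<in> level_set \<mu> t"
  shows "h_ideal (level_set \<mu> t)"
proof -
  note \<mu> = assms(1)[unfolded fuzzy_h_ideal_def]
  have "t \<le> \<mu> (a + b)" if "t \<le> \<mu> a" "t \<le> \<mu> b" for a b
    using \<mu> that by (meson min.boundedI order_trans)
  moreover have "t \<le> \<mu> (r * a) \<and> t \<le> \<mu> (a * r)" if "t \<le> \<mu> a" for a r
    using \<mu> that by (meson order_trans)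
  moreover have "t \<le> \<mu> u" if "t \<le> \<mu> a" "t \<le> \<mu> b" "u + a + y = b + y" for a b u y
    using \<mu> that by (meson min.boundedI order_trans)
  ultimately show ?thesis
    using assms(2) unfolding h_ideal_def level_set_def by blast
qed

text \<open>For values in {0,1}, each fuzzy inequality is an implication between membership
  statements, namely the matching closure property of \<open>A\<close>.\<close>

lemma fuzzy_h_ideal_of_bool:
  assumes "h_ideal A"
  shows "fuzzy_h_ideal (\<lambda>x. of_bool (x \<in> A))"
proof -
  have min_le: "min (of_bool P) (of_bool Q) \<le> (of_bool S :: real)" if "P \<Longrightarrow> Q \<Longrightarrow> S" for P Q S
    using that by (cases P; cases Q) auto
  have le: "of_bool P \<le> (of_bool S :: real)" if "P \<Longrightarrow> S" for P S
    using that by simp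
  show ?thesis
    unfolding fuzzy_h_ideal_def fuzzy_subset_def
  proof (intro conjI allI impI)
    show "min (of_bool (a \<in> A)) (of_bool (b \<in> A)) \<le> (of_bool (a + b \<in> A) :: real)" for a b
      by (rule min_le) (use assms in \<open>unfold h_ideal_def, blast\<close>)
    show "of_bool (a \<in> A) \<le> (of_bool (a * b \<in> A) :: real)" for a b
      by (rule le) (use assms in \<open>unfold h_ideal_def, blast\<close>)
    show "of_bool (b \<in> A) \<le> (of_bool (a * b \<in> A) :: real)" for a b
      by (rule le) (use assms in \<open>unfold h_ideal_def, blast\<close>)
    show "min (of_bool (a \<in> A)) (of_bool (b \<in> A)) \<le> (of_bool (x \<in> A) :: real)"
      if "x + a + y = b + y" for a b x y
      by (rule min_le) (use assms that in \<open>unfold h_ideal_def, blast\<close>)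
  qed simp_all
qed

text \<open>A minimum of finitely many numbers is at least \<open>t\<close> iff each of them is, so
  the expressions of value at least \<open>t\<close> are those with all factors in the level sets.
  The left side asks for an actual value, since a supremum of at least \<open>t\<close> need not be
  attained.\<close>

lemma ex_h_product_values_ge_iff:
  "(\<exists>v\<in>h_product_values \<mu> \<nu> x. t \<le> v) \<longleftrightarrow>
     x \<in> h_closure (set_product (level_set \<mu> t) (level_set \<nu> t))"
proof -
  \<comment> \<open>The bound \<open>1 \<le> m\<close> is essential: \<open>Min\<close> of the empty
    set is unspecified.\<close>
  have Min_ge: "t \<le> Min ((\<lambda>i. min (\<mu> (a i)) (\<nu> (b i))) ` {1..m}) \<longleftrightarrow>
      (\<forall>i\<in>{1..m}. a i \<in> level_set \<mu> t \<and> b i \<in> level_set \<nu> t)"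
    if "1 \<le> m" for m :: nat and a b
    using that by (subst Min_ge_iff) (auto simp: level_set_def)
  show ?thesis
  proof
    assume "\<exists>v\<in>h_product_values \<mu> \<nu> x. t \<le> v"
    then obtain m n :: nat and a b a' b' z where
      "1 \<le> m" "1 \<le> n" and eq: "x + (\<Sum>i=1..m. a i * b i) + z = (\<Sum>j=1..n. a' j * b' j) + z"
      and "t \<le> Min ((\<lambda>i. min (\<mu> (a i)) (\<nu> (b i))) ` {1..m})"
        "t \<le> Min ((\<lambda>j. min (\<mu> (a' j)) (\<nu> (b' j))) ` {1..n})"
      unfolding h_product_values_def by auto
    then have "(\<Sum>i=1..m. a i * b i) \<in> set_product (level_set \<mu> t) (level_set \<nu> t)"
        "(\<Sum>j=1..n. a' j * b' j) \<in> set_product (level_set \<mu> t) (level_set \<nu> t)"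
      unfolding set_product_def Min_ge[OF \<open>1 \<le> m\<close>] Min_ge[OF \<open>1 \<le> n\<close>] by blast+
    then show "x \<in> h_closure (set_product (level_set \<mu> t) (level_set \<nu> t))"
      using eq unfolding h_closure_def by blast
  next
    assume "x \<in> h_closure (set_product (level_set \<mu> t) (level_set \<nu> t))"
    then obtain m n :: nat and a b a' b' z where
      mn: "1 \<le> m" "1 \<le> n" and eq: "x + (\<Sum>i=1..m. a i * b i) + z = (\<Sum>j=1..n. a' j * b' j) + z"
      and ab: "\<forall>i\<in>{1..m}. a i \<in> level_set \<mu> t \<and> b i \<in> level_set \<nu> t"
        "\<forall>j\<in>{1..n}. a' j \<in> level_set \<mu> t \<and> b' j \<in> level_set \<nu> t"
      unfolding h_closure_def set_product_def by blast
    define v where "v = min (Min ((\<lambda>i. min (\<mu> (a i)) (\<nu> (b i))) ` {1..m}))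
      (Min ((\<lambda>j. min (\<mu> (a' j)) (\<nu> (b' j))) ` {1..n}))"
    have "v \<in> h_product_values \<mu> \<nu> x"
      unfolding h_product_values_def v_def using mn eq by blast
    moreover have "t \<le> v"
      unfolding v_def min.bounded_iff Min_ge[OF mn(1)] Min_ge[OF mn(2)] using ab by blast
    ultimately show "\<exists>v\<in>h_product_values \<mu> \<nu> x. t \<le> v" by blast
  qed
qed

text \<open>The value \<open>v\<close> itself serves as the height: \<open>x\<close> then lies in
  the closure of the product of the level sets at \<open>v\<close>, hence in both of them.\<close>

lemma h_product_values_le_fuzzy_min:
  assumes "fuzzy_h_ideal \<mu>" and "fuzzy_h_ideal \<nu>" and "v \<in> h_product_values \<mu> \<nu> x"
  shows "v \<le> fuzzy_min \<mu> \<nu> x"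
proof -
  let ?A = "level_set \<mu> v" and ?B = "level_set \<nu> v"
  have x: "x \<in> h_closure (set_product ?A ?B)"
    using ex_h_product_values_ge_iff assms(3) by blast
  then obtain m :: nat and a b
    where "1 \<le> m" "\<forall>i\<in>{1..m}. a i \<in> ?A \<and> b i \<in> ?B"
    unfolding h_closure_def set_product_def by blast
  \<comment> \<open>As \<open>1 \<le> m\<close>, the first factors show that neither level set is
    empty.\<close>
  then have "a 1 \<in> ?A" "b 1 \<in> ?B" by auto
  then have "h_ideal ?A" "h_ideal ?B"
    using assms(1,2) by (blast intro: h_ideal_level_set)+
  then have "x \<in> ?A \<inter> ?B" using h_closure_set_product_subset_Int x by blast
  then show ?thesis by (simp add: level_set_def fuzzy_min_def)
qed

text \<open>At the height \<open>fuzzy_min \<mu> \<nu> x\<close> both level sets contain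
  \<open>x\<close>, so the crisp equality yields a value at least that high. No value is higher, so
  the supremum is an attained maximum.\<close>

lemma h_intrinsic_product_eq_fuzzy_min:
  assumes S2: "\<And>A B :: 'a::semiring_0 set. h_ideal A \<Longrightarrow> h_ideal B \<Longrightarrow>
      A \<inter> B = h_closure (set_product A B)"
    and \<mu>: "fuzzy_h_ideal (\<mu> :: 'a \<Rightarrow> real)" and \<nu>: "fuzzy_h_ideal \<nu>"
  shows "\<mu> \<odot>\<^sub>h \<nu> = fuzzy_min \<mu> \<nu>"
proof
  fix x
  let ?t = "fuzzy_min \<mu> \<nu> x" and ?V = "h_product_values \<mu> \<nu> x"
  have x: "x \<in> level_set \<mu> ?t" "x \<in> level_set \<nu> ?t"
    by (auto simp: level_set_def fuzzy_min_def)
  then have "x \<in> h_closure (set_product (level_set \<mu> ?t) (level_set \<nu> ?t))"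
    using S2 h_ideal_level_set \<mu> \<nu> by blast
  then obtain v where v: "v \<in> ?V" "?t \<le> v"
    using ex_h_product_values_ge_iff by blast
  have le: "w \<le> ?t" if "w \<in> ?V" for w
    using h_product_values_le_fuzzy_min[OF \<mu> \<nu> that] .
  then have "?t \<in> ?V" using v by (metis order_antisym)
  then have "Sup ?V = ?t" using le by (rule cSup_eq_maximum)
  then show "(\<mu> \<odot>\<^sub>h \<nu>) x = ?t" using v by (auto simp: h_intrinsic_product_def)
qed

text \<open>At \<open>x \<in> A\<close> the supremum is 1, so some value exceeds 1/2, whether or not
  the supremum is attained; the level set of \<open>\<chi>\<close> at 1/2 is still
  \<open>A\<close>.\<close>

lemma h_idempotent_if_of_bool_idempotent:
  fixes A :: "'a::semiring_0 set"
  defines "\<chi> \<equiv> (\<lambda>x. of_bool (x \<in> A) :: real)"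
  assumes A: "h_ideal A" and idem: "\<chi> \<odot>\<^sub>h \<chi> = \<chi>"
  shows "h_idempotent A"
  unfolding h_idempotent_def
proof
  show "h_closure (set_product A A) \<subseteq> A"
    using h_closure_set_product_subset_Int[OF A A] by simp
next
  have level: "level_set \<chi> (1/2) = A"
    by (auto simp: level_set_def \<chi>_def of_bool_def split: if_splits)
  show "A \<subseteq> h_closure (set_product A A)"
  proof
    fix x assume "x \<in> A"
    then have one: "(\<chi> \<odot>\<^sub>h \<chi>) x = 1" unfolding idem by (simp add: \<chi>_def)
    \<comment> \<open>The value 1 differs from the default 0 that the product takes when no
      expression exists.\<close>
    then have "h_product_values \<chi> \<chi> x \<noteq> {}" "1/2 < Sup (h_product_values \<chi> \<chi> x)"
      by (auto simp: h_intrinsic_product_def split: if_splits)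
    then obtain v where "v \<in> h_product_values \<chi> \<chi> x" "1/2 < v"
      by (meson less_cSupE)
    then have "\<exists>v\<in>h_product_values \<chi> \<chi> x. 1/2 \<le> v" by force
    then show "x \<in> h_closure (set_product A A)"
      unfolding ex_h_product_values_ge_iff level .
  qed
qed

theorem theorem4p5:
  defines "S1 \<equiv> \<forall>A :: 'a::{semiring_0, monoid_mult} set. h_ideal A \<longrightarrow> h_idempotent A"
    and "S2 \<equiv> \<forall>A B :: 'a set. h_ideal A \<and> h_ideal B \<longrightarrow> A \<inter> B = h_closure (set_product A B)"
    and "S3 \<equiv> \<forall>\<mu> :: 'a \<Rightarrow> real. fuzzy_h_ideal \<mu> \<longrightarrow> \<mu> \<odot>\<^sub>h \<mu> = \<mu>"
    and "S4 \<equiv> \<forall>\<mu> \<nu> :: 'a \<Rightarrow> real. fuzzy_h_ideal \<mu> \<and> fuzzy_h_ideal \<nu> \<longrightarrow> \<mu> \<odot>\<^sub>h \<nu> = fuzzy_min \<mu> \<nu>"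
  shows "(S1 \<longleftrightarrow> S2) \<and> (S2 \<longleftrightarrow> S3) \<and> (S3 \<longleftrightarrow> S4)"
proof -
  \<comment> \<open>The equivalences follow from the cycle \<open>S1\<close>, \<open>S2\<close>,
    \<open>S4\<close>, \<open>S3\<close>, \<open>S1\<close>.\<close>
  have "S2" if S1
    unfolding S2_def
  proof (intro allI impI, elim conjE)
    fix A B :: "'a set"
    assume A: "h_ideal A" and B: "h_ideal B"
    have "A \<inter> B = h_closure (set_product (A \<inter> B) (A \<inter> B))"
      using \<open>S1\<close> h_ideal_Int[OF A B] unfolding S1_def h_idempotent_def by metis
    also have "\<dots> \<subseteq> h_closure (set_product A B)"
      by (intro h_closure_mono set_product_mono) auto
    \<comment> \<open>The chain gives only the inclusion from left to right; the other one holds for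
      any two \<open>h\<close>-ideals.\<close>
    finally show "A \<inter> B = h_closure (set_product A B)"
      using h_closure_set_product_subset_Int[OF A B] by blast
  qed
  moreover have "S4" if S2
    unfolding S4_def
  proof (intro allI impI, elim conjE)
    fix \<mu> \<nu> :: "'a \<Rightarrow> real"
    assume "fuzzy_h_ideal \<mu>" and "fuzzy_h_ideal \<nu>"
    then show "\<mu> \<odot>\<^sub>h \<nu> = fuzzy_min \<mu> \<nu>"
    proof (rule h_intrinsic_product_eq_fuzzy_min[rotated])
      show "A \<inter> B = h_closure (set_product A B)" if "h_ideal A" "h_ideal B" for A B :: "'a set"
        using \<open>S2\<close>[unfolded S2_def] that by blast
    qed
  qed
  moreover have "S3" if S4
    unfolding S3_def
  proof (intro allI impI)
    fix \<mu> :: "'a \<Rightarrow> real"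
    assume "fuzzy_h_ideal \<mu>"
    then have "\<mu> \<odot>\<^sub>h \<mu> = fuzzy_min \<mu> \<mu>" using \<open>S4\<close>[unfolded S4_def] by blast
    then show "\<mu> \<odot>\<^sub>h \<mu> = \<mu>" by (simp add: fuzzy_min_def)
  qed
  moreover have "S1" if S3
    unfolding S1_def
  proof (intro allI impI)
    fix A :: "'a set"
    assume A: "h_ideal A"
    show "h_idempotent A"
      using h_idempotent_if_of_bool_idempotent[OF A]
        \<open>S3\<close>[unfolded S3_def, rule_format, OF fuzzy_h_ideal_of_bool[OF A]] .
  qed
  ultimately show ?thesis by blast
qed

end
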